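(* Suppose that $x(t)\in\mathbb R^n$ belongs to the feasibility region of the HMPC formulation, i.e., the optimization problem $\mathbb H(x(t);x_r,u_r)$ defined in the context is feasible. Let $\mathbf x=\{x_0,\dots,x_{N-1}\}$, $\mathbf u=\{u_0,\dots,u_{N-1}\}$, $x_e,x_s,x_c,u_e,u_s,u_c$ be a feasible solution of $\mathbb H(x(t);x_r,u_r)$ for a given $(x_r,u_r)\in\mathbb R^n\times\mathbb R^m$. Then the successor state $Ax(t)+Bu_0$ belongs to the feasibility region of the HMPC formulation for any $(\hat x_r,\hat u_r)\in\mathbb R^n\times\mathbb R^m$, i.e., $\mathbb H(Ax(t)+Bu_0;\hat x_r,\hat u_r)$ is feasible.
   Context: System: $x(t+1)=Ax(t)+Bu(t)$, $x(t)\in\mathbb R^n$, $u(t)\in\mathbb R^m$, $(A,B)$ controllable, with constraints $(x(t),u(t))\in\mathcal Y=\{(x,u):\underline y\le Ex+Fu\le\overline y\}$, where $\underline y,\overline y\in\mathbb R^p$, $E\in\mathbb R^{p\times n}$, $F\in\mathbb R^{p\times m}$ and $\mathcal Y$ has non-empty interior. $N\ge1$ is an integer (prediction horizon), $w\ge0$ a real number (base frequency), $\varepsilon_y\in\mathbb R^p$ a vector with (arbitrarily small) positive components with $\underline y+\varepsilon_y<\overline y-\varepsilon_y$. Vector inequalities are componentwise; $v_{(i)}$ is the $i$-th component of $v$; $\|v\|_M^2=v^\top Mv$. Cost matrices: $Q\in\mathbb R^{n\times n}$, $R\in\mathbb R^{m\times m}$ symmetric positive definite; $T_e,T_h\in\mathbb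 R^{n\times n}$ and $S_e,S_h\in\mathbb R^{m\times m}$ diagonal positive definite. HMPC problem $\mathbb H(x(t);x_r,u_r)$: decision variables $\mathbf x=(x_0,\dots)$, $\mathbf u=(u_0,\dots,u_{N-1})$, $x_e,x_s,x_c\in\mathbb R^n$, $u_e,u_s,u_c\in\mathbb R^m$. With $x_{hj}=x_e+x_s\sin(w(j-N))+x_c\cos(w(j-N))$, $u_{hj}=u_e+u_s\sin(w(j-N))+u_c\cos(w(j-N))$, and $y_e=Ex_e+Fu_e$, $y_s=Ex_s+Fu_s$, $y_c=Ex_c+Fu_c$, minimize $$\sum_{j=0}^{N-1}\left(\|x_j-x_{hj}\|_Q^2+\|u_j-u_{hj}\|_R^2\right)+\|x_e-x_r\|_{T_e}^2+\|u_e-u_r\|_{S_e}^2+\|x_s\|_{T_h}^2+\|x_c\|_{T_h}^2+\|u_s\|_{S_h}^2+\|u_c\|_{S_h}^2$$ subject to: $x_{j+1}=Ax_j+Bu_j$ and $\underline y\le Ex_j+Fu_j\le\overline y$ for $0\le j\le N-1$; $x_0=x(t)$; $x_N=x_e+x_c$; $x_e=Ax_e+Bu_e$; $x_s\cos(w)-x_c\sin(w)=Ax_s+Bu_s$; $x_s\sin(w)+x_c\cos(w)=Ax_c+Bu_c$; and, for $1\le i\le p$, $\sqrt{y_{s(i)}^2+y_{c(i)}^2}\le y_{e(i)}-\underline y_{(i)}-\varepsilon_{y(i)}$ and $\sqrt{y_{s(i)}^2+y_{c(i)}^2}\le\overline y_{(i)}-\varepsilon_{y(i)}-y_{e(i)}$.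 (Here $x_N$ is determined by $x_N=Ax_{N-1}+Bu_{N-1}$.) The feasibility region of the HMPC formulation is the set of states $x(t)$ for which $\mathbb H(x(t);x_r,u_r)$ is feasible. *)

theory Defs
  imports "HOL-Analysis.Analysis"
begin

definition symmetric_matrix :: "real^'k^'k \<Rightarrow> bool" where
  "symmetric_matrix M \<longleftrightarrow> transpose M = M"

definition diagonal_matrix :: "real^'k^'k \<Rightarrow> bool" where
  "diagonal_matrix M \<longleftrightarrow> (\<forall>i j. i \<noteq> j \<longrightarrow> M $ i $ j = 0)"

definition wnorm_sq :: "real^'k^'k \<Rightarrow> real^'k \<Rightarrow> real" where
  "wnorm_sq M v = v \<bullet> (M *v v)"

definition positive_definite :: "real^'k^'k \<Rightarrow> bool" where
  "positive_definite M \<longleftrightarrow> (\<forall>v. v \<noteq> 0 \<longrightarrow> 0 < wnorm_sq M v)"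

text \<open>The state-transfer definition; it is equivalent to the Kalman rank condition.\<close>

definition controllable :: "real^'n^'n \<Rightarrow> real^'m^'n \<Rightarrow> bool" where
  "controllable A B \<longleftrightarrow>
     (\<forall>a b. \<exists>T (x :: nat \<Rightarrow> real^'n) (u :: nat \<Rightarrow> real^'m).
        x 0 = a \<and> (\<forall>t<T. x (Suc t) = A *v x t + B *v u t) \<and> x T = b)"

record ('n::finite, 'm::finite, 'p::finite) hmpc_data =
  mat_A :: "real^'n^'n"
  mat_B :: "real^'m^'n"
  mat_E :: "real^'n^'p"
  mat_F :: "real^'m^'p"
  y_lo :: "real^'p"
  y_up :: "real^'p"
  eps_y :: "real^'p"
  horizon :: nat
  base_freq :: real
  mat_Q :: "real^'n^'n"
  mat_R :: "real^'m^'m"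
  mat_Te :: "real^'n^'n"
  mat_Th :: "real^'n^'n"
  mat_Se :: "real^'m^'m"
  mat_Sh :: "real^'m^'m"

definition constrained_output :: "('n::finite, 'm::finite, 'p::finite) hmpc_data \<Rightarrow> real^'n \<Rightarrow> real^'m \<Rightarrow> real^'p" where
  "constrained_output P x u = mat_E P *v x + mat_F P *v u"

definition constraint_Y :: "('n::finite, 'm::finite, 'p::finite) hmpc_data \<Rightarrow> ((real^'n) \<times> (real^'m)) set" where
  "constraint_Y P = {(x, u). \<forall>i. y_lo P $ i \<le> constrained_output P x u $ i \<and> constrained_output P x u $ i \<le> y_up P $ i}"

text \<open>
  Sequences are total functions on the natural numbers. Only the entries
  \<open>0, \<dots>, N\<close> of \<open>seq_x\<close> and \<open>0, \<dots>, N - 1\<close> of \<open>seq_u\<close> occur in the problem; the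
  entry \<open>N\<close> of \<open>seq_x\<close> is determined by the dynamics constraint.
\<close>

record ('n::finite, 'm::finite) hmpc_vars =
  seq_x :: "nat \<Rightarrow> real^'n"
  seq_u :: "nat \<Rightarrow> real^'m"
  var_xe :: "real^'n"
  var_xs :: "real^'n"
  var_xc :: "real^'n"
  var_ue :: "real^'m"
  var_us :: "real^'m"
  var_uc :: "real^'m"

definition harmonic :: "real \<Rightarrow> nat \<Rightarrow> real^'k \<Rightarrow> real^'k \<Rightarrow> real^'k \<Rightarrow> nat \<Rightarrow> real^'k" where
  "harmonic w N ve vs vc j =
     ve + sin (w * (real j - real N)) *\<^sub>R vs + cos (w * (real j - real N)) *\<^sub>R vc"

definition hmpc_cost ::
    "('n::finite, 'm::finite, 'p::finite) hmpc_data \<Rightarrow> real^'n \<Rightarrow> real^'m \<Rightarrow> ('n, 'm) hmpc_vars \<Rightarrow> real" where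
  "hmpc_cost P xr ur z =
     (let w = base_freq P; N = horizon P;
          xh = harmonic w N (var_xe z) (var_xs z) (var_xc z);
          uh = harmonic w N (var_ue z) (var_us z) (var_uc z)
      in (\<Sum>j<N. wnorm_sq (mat_Q P) (seq_x z j - xh j) + wnorm_sq (mat_R P) (seq_u z j - uh j))
         + wnorm_sq (mat_Te P) (var_xe z - xr) + wnorm_sq (mat_Se P) (var_ue z - ur)
         + wnorm_sq (mat_Th P) (var_xs z) + wnorm_sq (mat_Th P) (var_xc z)
         + wnorm_sq (mat_Sh P) (var_us z) + wnorm_sq (mat_Sh P) (var_uc z))"

definition hmpc_constraints ::
    "('n::finite, 'm::finite, 'p::finite) hmpc_data \<Rightarrow> real^'n \<Rightarrow> ('n, 'm) hmpc_vars \<Rightarrow> bool" where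
  "hmpc_constraints P x z \<longleftrightarrow>
     (let A = mat_A P; B = mat_B P; w = base_freq P; N = horizon P;
          xe = var_xe z; xs = var_xs z; xc = var_xc z;
          ue = var_ue z; us = var_us z; uc = var_uc z;
          ye = constrained_output P xe ue; ys = constrained_output P xs us; yc = constrained_output P xc uc
      in (\<forall>j<N. seq_x z (Suc j) = A *v seq_x z j + B *v seq_u z j)
       \<and> (\<forall>j<N. (seq_x z j, seq_u z j) \<in> constraint_Y P)
       \<and> seq_x z 0 = x
       \<and> seq_x z N = xe + xc
       \<and> xe = A *v xe + B *v ue
       \<and> cos w *\<^sub>R xs - sin w *\<^sub>R xc = A *v xs + B *v us
       \<and> sin w *\<^sub>R xs + cos w *\<^sub>R xc = A *v xc + B *v uc
       \<and> (\<forall>i. sqrt ((ys $ i)\<^sup>2 + (yc $ i)\<^sup>2) \<le> ye $ i - y_lo P $ i - eps_y P $ i)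
       \<and> (\<forall>i. sqrt ((ys $ i)\<^sup>2 + (yc $ i)\<^sup>2) \<le> y_up P $ i - eps_y P $ i - ye $ i))"

record 'z opt_problem =
  objective :: "'z \<Rightarrow> real"
  feasible_set :: "'z set"

definition problem_feasible :: "'z opt_problem \<Rightarrow> bool" where
  "problem_feasible \<P> \<longleftrightarrow> (\<exists>z. z \<in> feasible_set \<P>)"

definition HMPC ::
    "('n::finite, 'm::finite, 'p::finite) hmpc_data \<Rightarrow> real^'n \<Rightarrow> real^'n \<Rightarrow> real^'m
      \<Rightarrow> ('n, 'm) hmpc_vars opt_problem" where
  "HMPC P x xr ur =
     \<lparr> objective = hmpc_cost P xr ur, feasible_set = {z. hmpc_constraints P x z} \<rparr>"

text \<open>
  The reference occurs only in the objective, so the region does not in fact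
  depend on it; it is kept as a parameter because it is part of the problem.
\<close>

definition feasibility_region ::
    "('n::finite, 'm::finite, 'p::finite) hmpc_data \<Rightarrow> real^'n \<Rightarrow> real^'m \<Rightarrow> (real^'n) set" where
  "feasibility_region P xr ur = {x. problem_feasible (HMPC P x xr ur)}"

end

theory Submission
  imports Defs
begin

text \<open>
  Recursive feasibility follows from a shift argument. A feasible solution ends at
  \<open>x\<^sub>N = x\<^sub>e + x\<^sub>c\<close>, which is the value at time \<open>N\<close> of the harmonic trajectory
  \<open>x\<^sub>h\<close>, and the three harmonic equality constraints say that \<open>(x\<^sub>h, u\<^sub>h)\<close> is a trajectory
  of the system. For the successor state one drops the first input, applies
  \<open>u\<^sub>e + u\<^sub>c\<close> at time \<open>N\<close>, and describes the same harmonic trajectory relative to the new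
  final time: the pair of sine and cosine coefficients is rotated by the angle \<open>w\<close>.
  Since the system is linear, the rotated coefficients satisfy the same equations. Since a
  rotation preserves \<open>y\<^sub>s\<^sup>2 + y\<^sub>c\<^sup>2\<close> in every component, the amplitude constraints are unchanged.
  The only new stage constraint, at time \<open>N\<close>, holds because \<open>\<bar>y\<^sub>c\<bar>\<close> is at most the amplitude
  \<open>sqrt (y\<^sub>s\<^sup>2 + y\<^sub>c\<^sup>2)\<close>, which the amplitude constraints bound by the distance from \<open>y\<^sub>e\<close> to
  either limit, less a nonnegative margin. The reference occurs in the cost alone and so plays no role.
\<close>

lemma matrix_vector_pair_lincomb:
  fixes M :: "real^'a^'c" and L :: "real^'b^'c"
  shows "M *v (a *\<^sub>R x + b *\<^sub>R x') + L *v (a *\<^sub>R u + b *\<^sub>R u')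
       = a *\<^sub>R (M *v x + L *v u) + b *\<^sub>R (M *v x' + L *v u')"
  by (simp add: matrix_vector_right_distrib matrix_vector_mult_scaleR scaleR_add_right)

lemma constrained_output_lincomb:
  "constrained_output P (a *\<^sub>R x + b *\<^sub>R x') (a *\<^sub>R u + b *\<^sub>R u')
     = a *\<^sub>R constrained_output P x u + b *\<^sub>R constrained_output P x' u'"
  unfolding constrained_output_def by (rule matrix_vector_pair_lincomb)

lemma constrained_output_add:
  "constrained_output P (x + x') (u + u') = constrained_output P x u + constrained_output P x' u'"
  using constrained_output_lincomb[of P 1 x 1 x' u u'] by simp

lemma rotation_sum_squares:
  fixes s c :: real
  shows "(cos w * s - sin w * c)\<^sup>2 + (sin w * s + cos w * c)\<^sup>2 = s\<^sup>2 + c\<^sup>2"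
proof -
  have "(cos w * s - sin w * c)\<^sup>2 + (sin w * s + cos w * c)\<^sup>2
      = ((sin w)\<^sup>2 + (cos w)\<^sup>2) * (s\<^sup>2 + c\<^sup>2)"
    by algebra
  then show ?thesis by simp
qed

text \<open>
  Coefficients of a harmonic signal after the reference time of its phase has been advanced by
  one step: \<open>v\<^sub>s sin (\<theta> + w) + v\<^sub>c cos (\<theta> + w)\<close> has sine coefficient \<open>rot_sin w v\<^sub>s v\<^sub>c\<close> and
  cosine coefficient \<open>rot_cos w v\<^sub>s v\<^sub>c\<close> as a function of \<open>\<theta>\<close>.
\<close>

definition rot_sin :: "real \<Rightarrow> real^'k \<Rightarrow> real^'k \<Rightarrow> real^'k" where
  "rot_sin w vs vc = cos w *\<^sub>R vs - sin w *\<^sub>R vc"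

definition rot_cos :: "real \<Rightarrow> real^'k \<Rightarrow> real^'k \<Rightarrow> real^'k" where
  "rot_cos w vs vc = sin w *\<^sub>R vs + cos w *\<^sub>R vc"

lemma matrix_vector_pair_rot:
  fixes M :: "real^'a^'c" and L :: "real^'b^'c"
  shows "M *v rot_sin w x x' + L *v rot_sin w u u' = rot_sin w (M *v x + L *v u) (M *v x' + L *v u')"
    and "M *v rot_cos w x x' + L *v rot_cos w u u' = rot_cos w (M *v x + L *v u) (M *v x' + L *v u')"
  using matrix_vector_pair_lincomb[of M "cos w" x "- sin w" x' L u u']
    matrix_vector_pair_lincomb[of M "sin w" x "cos w" x' L u u']
  by (simp_all add: rot_sin_def rot_cos_def)

lemma constrained_output_rot:
  "constrained_output P (rot_sin w x x') (rot_sin w u u')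
     = rot_sin w (constrained_output P x u) (constrained_output P x' u')"
  "constrained_output P (rot_cos w x x') (rot_cos w u u')
     = rot_cos w (constrained_output P x u) (constrained_output P x' u')"
  unfolding constrained_output_def by (rule matrix_vector_pair_rot)+

lemma rot_component_sum_squares:
  "(rot_sin w vs vc $ i)\<^sup>2 + (rot_cos w vs vc $ i)\<^sup>2 = (vs $ i)\<^sup>2 + (vc $ i)\<^sup>2"
  by (simp add: rot_sin_def rot_cos_def rotation_sum_squares)

text \<open>
  The shifted candidate for the successor state. The state entry at index \<open>N\<close> is the new
  terminal state, \<open>x\<^sub>e\<close> plus the rotated cosine coefficient.
\<close>

definition hmpc_shift ::
    "('n::finite, 'm::finite, 'p::finite) hmpc_data \<Rightarrow> ('n, 'm) hmpc_vars \<Rightarrow> ('n, 'm) hmpc_vars" where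
  "hmpc_shift P z =
     (let w = base_freq P; N = horizon P in
      \<lparr> seq_x = (\<lambda>j. if j < N then seq_x z (Suc j) else var_xe z + rot_cos w (var_xs z) (var_xc z)),
        seq_u = (\<lambda>j. if Suc j < N then seq_u z (Suc j) else var_ue z + var_uc z),
        var_xe = var_xe z,
        var_xs = rot_sin w (var_xs z) (var_xc z),
        var_xc = rot_cos w (var_xs z) (var_xc z),
        var_ue = var_ue z,
        var_us = rot_sin w (var_us z) (var_uc z),
        var_uc = rot_cos w (var_us z) (var_uc z) \<rparr>)"

text \<open>The appended input \<open>u\<^sub>e + u\<^sub>c\<close> is admissible at the terminal state \<open>x\<^sub>e + x\<^sub>c\<close>.\<close>

lemma terminal_pair_in_constraint_Y:
  assumes feas: "hmpc_constraints P x z" and eps: "\<forall>i. 0 \<le> eps_y P $ i"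
  shows "(var_xe z + var_xc z, var_ue z + var_uc z) \<in> constraint_Y P"
proof -
  define ye ys yc where "ye = constrained_output P (var_xe z) (var_ue z)"
    and "ys = constrained_output P (var_xs z) (var_us z)"
    and "yc = constrained_output P (var_xc z) (var_uc z)"
  have bounds: "sqrt ((ys $ i)\<^sup>2 + (yc $ i)\<^sup>2) \<le> ye $ i - y_lo P $ i - eps_y P $ i"
    "sqrt ((ys $ i)\<^sup>2 + (yc $ i)\<^sup>2) \<le> y_up P $ i - eps_y P $ i - ye $ i" for i
    using feas by (simp_all add: hmpc_constraints_def Let_def ye_def ys_def yc_def)
  have "y_lo P $ i \<le> (ye + yc) $ i \<and> (ye + yc) $ i \<le> y_up P $ i" for i
  proof -
    have "\<bar>yc $ i\<bar> \<le> sqrt ((ys $ i)\<^sup>2 + (yc $ i)\<^sup>2)"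
      by (rule real_sqrt_ge_abs2)
    then show ?thesis
      using bounds[of i] eps[rule_format, of i] unfolding vector_add_component by linarith
  qed
  then show ?thesis
    by (simp add: constraint_Y_def constrained_output_add ye_def yc_def)
qed

lemma hmpc_constraints_shift:
  assumes feas: "hmpc_constraints P x z"
    and N: "horizon P \<ge> 1" and eps: "\<forall>i. 0 \<le> eps_y P $ i"
  shows "hmpc_constraints P (mat_A P *v x + mat_B P *v seq_u z 0) (hmpc_shift P z)"
proof -
  define A B w N where "A = mat_A P" and "B = mat_B P" and "w = base_freq P" and "N = horizon P"
  define xe xs xc where "xe = var_xe z" and "xs = var_xs z" and "xc = var_xc z"
  define ue us uc where "ue = var_ue z" and "us = var_us z" and "uc = var_uc z"
  note defs = A_def B_def w_def N_def xe_def xs_def xc_def ue_def us_def uc_def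
  have dyn: "\<forall>j<N. seq_x z (Suc j) = A *v seq_x z j + B *v seq_u z j"
    and stage: "\<forall>j<N. (seq_x z j, seq_u z j) \<in> constraint_Y P"
    and init: "seq_x z 0 = x" and final: "seq_x z N = xe + xc"
    and eq_e: "A *v xe + B *v ue = xe"
    and eq_s: "A *v xs + B *v us = rot_sin w xs xc"
    and eq_c: "A *v xc + B *v uc = rot_cos w xs xc"
    using feas by (simp_all add: hmpc_constraints_def Let_def rot_sin_def rot_cos_def defs)
  have amp: "\<forall>i. sqrt ((constrained_output P xs us $ i)\<^sup>2 + (constrained_output P xc uc $ i)\<^sup>2)
        \<le> constrained_output P xe ue $ i - y_lo P $ i - eps_y P $ i"
    "\<forall>i. sqrt ((constrained_output P xs us $ i)\<^sup>2 + (constrained_output P xc uc $ i)\<^sup>2)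
        \<le> y_up P $ i - eps_y P $ i - constrained_output P xe ue $ i"
    using feas by (simp_all add: hmpc_constraints_def Let_def defs)
  define z' where "z' = hmpc_shift P z"
  have shift: "seq_x z' = (\<lambda>j. if j < N then seq_x z (Suc j) else xe + rot_cos w xs xc)"
    "seq_u z' = (\<lambda>j. if Suc j < N then seq_u z (Suc j) else ue + uc)"
    "var_xe z' = xe" "var_xs z' = rot_sin w xs xc" "var_xc z' = rot_cos w xs xc"
    "var_ue z' = ue" "var_us z' = rot_sin w us uc" "var_uc z' = rot_cos w us uc"
    by (simp_all add: z'_def hmpc_shift_def Let_def defs cong: if_cong)
  have N_pos: "0 < N" using N by (simp add: N_def)
  have last_step: "A *v (xe + xc) + B *v (ue + uc) = xe + rot_cos w xs xc"
    using eq_e eq_c matrix_vector_pair_lincomb[of A 1 xe 1 xc B ue uc] by simp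
  have "seq_x z' (Suc j) = A *v seq_x z' j + B *v seq_u z' j" if "j < N" for j
  proof (cases "Suc j < N")
    case True
    then show ?thesis using dyn by (simp add: shift)
  next
    case False
    with that have "Suc j = N" by simp
    then show ?thesis using final last_step by (auto simp: shift)
  qed
  moreover have "(seq_x z' j, seq_u z' j) \<in> constraint_Y P" if "j < N" for j
  proof (cases "Suc j < N")
    case True
    then show ?thesis using stage by (simp add: shift)
  next
    case False
    with that have "Suc j = N" by simp
    then show ?thesis
      using final terminal_pair_in_constraint_Y[OF feas eps] by (auto simp: shift defs)
  qed
  moreover have "seq_x z' 0 = A *v x + B *v seq_u z 0"
    using dyn init N_pos by (simp add: shift)
  moreover have "A *v rot_sin w xs xc + B *v rot_sin w us uc
      = rot_sin w (rot_sin w xs xc) (rot_cos w xs xc)"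
    "A *v rot_cos w xs xc + B *v rot_cos w us uc
      = rot_cos w (rot_sin w xs xc) (rot_cos w xs xc)"
    by (simp_all add: matrix_vector_pair_rot eq_s eq_c)
  ultimately show ?thesis
    unfolding hmpc_constraints_def Let_def z'_def[symmetric]
      A_def[symmetric] B_def[symmetric] w_def[symmetric] N_def[symmetric]
    using amp
    by (simp add: shift eq_e constrained_output_rot rot_component_sum_squares
        rot_sin_def[symmetric] rot_cos_def[symmetric])
qed

theorem theorem6p9:
  fixes P :: "('n::finite, 'm::finite, 'p::finite) hmpc_data"
    and x xr :: "real^'n" and ur :: "real^'m"
    and z :: "('n, 'm) hmpc_vars"
  assumes "controllable (mat_A P) (mat_B P)"
    and "interior (constraint_Y P) \<noteq> {}"
    and "horizon P \<ge> 1"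
    and "base_freq P \<ge> 0"
    and "\<forall>i. 0 < eps_y P $ i"
    and "\<forall>i. y_lo P $ i + eps_y P $ i < y_up P $ i - eps_y P $ i"
    and "symmetric_matrix (mat_Q P)" and "positive_definite (mat_Q P)"
    and "symmetric_matrix (mat_R P)" and "positive_definite (mat_R P)"
    and "diagonal_matrix (mat_Te P)" and "positive_definite (mat_Te P)"
    and "diagonal_matrix (mat_Th P)" and "positive_definite (mat_Th P)"
    and "diagonal_matrix (mat_Se P)" and "positive_definite (mat_Se P)"
    and "diagonal_matrix (mat_Sh P)" and "positive_definite (mat_Sh P)"
    and "x \<in> feasibility_region P xr ur"
    and "z \<in> feasible_set (HMPC P x xr ur)"
  shows "\<forall>xr' ur'. mat_A P *v x + mat_B P *v seq_u z 0 \<in> feasibility_region P xr' ur'"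
proof (intro allI)
  fix xr' :: "real^'n" and ur' :: "real^'m"
  have "hmpc_constraints P x z"
    using assms(20) by (simp add: HMPC_def)
  moreover have "\<forall>i. 0 \<le> eps_y P $ i"
    using assms(5) by (simp add: less_imp_le)
  ultimately have "hmpc_constraints P (mat_A P *v x + mat_B P *v seq_u z 0) (hmpc_shift P z)"
    using assms(3) by (intro hmpc_constraints_shift)
  then show "mat_A P *v x + mat_B P *v seq_u z 0 \<in> feasibility_region P xr' ur'"
    by (auto simp: feasibility_region_def problem_feasible_def HMPC_def)
qed

end
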